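(* There exists a constant $c>0$ such that for every integer $n\geq 1$ and every integer $N\geq 2^{cn^{4}(\log_2 n)^2}$, every $8n^2\times N$ real matrix contains an $n\times n$ row-monotone submatrix.
   Context: An $n\times n$ submatrix of a real matrix $A$ is obtained by choosing row indices $i_1<\dots<i_n$ and column indices $j_1<\dots<j_n$ and taking $B(k,l)=A(i_k,j_l)$. A matrix is row-monotone if either every row is monotone increasing (non-decreasing) or every row is monotone decreasing (non-increasing). *)

theory Defs
  imports Complex_Main "Jordan_Normal_Form.DL_Submatrix"
begin

text \<open>
  \<^const>\<open>submatrix\<close> silently intersects the index sets with the index ranges of the matrix;
  the inclusions below ensure that exactly \<open>n\<close> existing rows and columns are chosen.
  Indices start at 0.
\<close>

definition is_square_submatrix :: "nat \<Rightarrow> 'a mat \<Rightarrow> 'a mat \<Rightarrow> bool" where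
  "is_square_submatrix n A B \<longleftrightarrow>
     (\<exists>I J. I \<subseteq> {..<dim_row A} \<and> card I = n \<and> J \<subseteq> {..<dim_col A} \<and> card J = n \<and>
            B = submatrix A I J)"

definition row_monotone :: "'a::order mat \<Rightarrow> bool" where
  "row_monotone B \<longleftrightarrow>
     (\<forall>i<dim_row B. mono_on {..<dim_col B} (\<lambda>j. B $$ (i, j))) \<or>
     (\<forall>i<dim_row B. antimono_on {..<dim_col B} (\<lambda>j. B $$ (i, j)))"

text \<open>\<^const>\<open>is_square_submatrix\<close> restated with increasing sequences of row and column indices.\<close>

lemma strict_mono_on_pick:
  assumes "finite I"
  shows "strict_mono_on {..<card I} (pick I)"
  using assms pick_mono_le by (auto simp: strict_mono_on_def)

lemma pick_eq_strict_mono_on: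
  assumes r: "strict_mono_on {..<n} r" and k: "k < n"
  shows "pick (r ` {..<n}) k = r k"
proof -
  have eq: "{a \<in> r ` {..<n}. a < r k} = r ` {..<k}"
    using r k by (auto simp: strict_mono_on_less)
  have "inj_on r {..<n}"
    using r by (rule strict_mono_on_imp_inj_on)
  then have "inj_on r {..<k}"
    by (rule inj_on_subset) (use k in auto)
  then have "card {a \<in> r ` {..<n}. a < r k} = k"
    unfolding eq by (simp add: card_image)
  moreover have "r k \<in> r ` {..<n}"
    using k by blast
  ultimately show ?thesis
    using pick_card_in_set by metis
qed

lemma is_square_submatrix_iff:
  "is_square_submatrix n A B \<longleftrightarrow>
     (\<exists>r c. strict_mono_on {..<n} r \<and> r ` {..<n} \<subseteq> {..<dim_row A} \<and>
            strict_mono_on {..<n} c \<and> c ` {..<n} \<subseteq> {..<dim_col A} \<and>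
            B = mat n n (\<lambda>(k, l). A $$ (r k, c l)))"
proof
  have dim: "card {i. i < m \<and> i \<in> I} = card I" if "I \<subseteq> {..<m}" for I :: "nat set" and m
    using that by (intro arg_cong[where f = card]) auto
  {
    assume "is_square_submatrix n A B"
    then obtain I J where I: "I \<subseteq> {..<dim_row A}" "card I = n"
      and J: "J \<subseteq> {..<dim_col A}" "card J = n" and B: "B = submatrix A I J"
      unfolding is_square_submatrix_def by blast
    have fin: "finite I" "finite J"
      using I J finite_subset by blast+
    have "pick I ` {..<n} \<subseteq> I" "pick J ` {..<n} \<subseteq> J"
      using I J by (auto intro: pick_in_set_le)
    then have "pick I ` {..<n} \<subseteq> {..<dim_row A}" "pick J ` {..<n} \<subseteq> {..<dim_col A}"
      using I(1) J(1) by (meson subset_trans)+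
    moreover have "strict_mono_on {..<n} (pick I)" "strict_mono_on {..<n} (pick J)"
      using strict_mono_on_pick fin I(2) J(2) by metis+
    moreover have "B = mat n n (\<lambda>(k, l). A $$ (pick I k, pick J l))"
      unfolding B submatrix_def using I J by (simp add: dim)
    ultimately show "\<exists>r c. strict_mono_on {..<n} r \<and> r ` {..<n} \<subseteq> {..<dim_row A} \<and>
            strict_mono_on {..<n} c \<and> c ` {..<n} \<subseteq> {..<dim_col A} \<and>
            B = mat n n (\<lambda>(k, l). A $$ (r k, c l))"
      by (intro exI[of _ "pick I"] exI[of _ "pick J"] conjI)
  }
  assume "\<exists>r c. strict_mono_on {..<n} r \<and> r ` {..<n} \<subseteq> {..<dim_row A} \<and>
            strict_mono_on {..<n} c \<and> c ` {..<n} \<subseteq> {..<dim_col A} \<and>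
            B = mat n n (\<lambda>(k, l). A $$ (r k, c l))"
  then obtain r c where r: "strict_mono_on {..<n} r" "r ` {..<n} \<subseteq> {..<dim_row A}"
    and c: "strict_mono_on {..<n} c" "c ` {..<n} \<subseteq> {..<dim_col A}"
    and B: "B = mat n n (\<lambda>(k, l). A $$ (r k, c l))"
    by blast
  have card: "card (r ` {..<n}) = n" "card (c ` {..<n}) = n"
    using r(1) c(1) by (simp_all add: card_image strict_mono_on_imp_inj_on)
  have "B = submatrix A (r ` {..<n}) (c ` {..<n})"
    unfolding B submatrix_def dim[OF r(2)] dim[OF c(2)] card
    by (rule cong_mat) (auto simp: pick_eq_strict_mono_on r c)
  then show "is_square_submatrix n A B"
    unfolding is_square_submatrix_def using r(2) c(2) card
    by (intro exI[of _ "r ` {..<n}"] exI[of _ "c ` {..<n}"] conjI)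
qed

end

theory Submission
  imports Defs "HOL-Library.Sublist"
begin

text \<open>
  Let \<open>m = 8 n\<^sup>2\<close> be the number of rows.  Halving both sides once per row, any set of columns contains
  two sets \<open>A < B\<close>, smaller by a factor \<open>2 ^ (m + 1)\<close>, such that each row compares all of \<open>A\<close> with all of
  \<open>B\<close> in the same direction.  Iterating \<open>d\<close> times gives a binary tree of depth \<open>d\<close> whose inner nodes
  are labelled by sign vectors.  A counting argument in the style of Pajor's proof of the
  Sauer--Shelah lemma finds in it a complete binary subtree of depth \<open>k\<close> whose labels depend on the
  level only, as soon as \<open>2 ^ d\<close> exceeds the number of sequences of fewer than \<open>k\<close> pairs of a level
  and a sign vector; \<open>d = 4 m k\<close> suffices.

  With \<open>n \<le> 2 ^ j < 2 n\<close> and \<open>k = 4 j\<^sup>2\<close>, double counting yields \<open>j\<close> of the \<open>k\<close> levels on which \<open>n\<close> rows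
  have one and the same sign.  The subtree spanned by these levels has \<open>2 ^ j \<ge> n\<close> leaves, which are
  the columns sought.
\<close>

section \<open>Column sets as binary trees with labelled levels\<close>

definition separated :: "('r \<Rightarrow> 'c::linorder \<Rightarrow> 'a::linorder) \<Rightarrow> 'r set \<Rightarrow> 'r set \<Rightarrow> 'c set \<Rightarrow> 'c set \<Rightarrow> bool" where
  "separated f R \<sigma> A B \<longleftrightarrow>
     (\<forall>x\<in>A. \<forall>y\<in>B. x < y \<and> (\<forall>r\<in>R. if r \<in> \<sigma> then f r x \<le> f r y else f r y \<le> f r x))"

text \<open>
  The list gives, from the root downwards, the common label of each level; a sign vector is encoded
  as the set of rows on which it is positive.
\<close>

fun level_homogeneous :: "('r \<Rightarrow> 'c::linorder \<Rightarrow> 'a::linorder) \<Rightarrow> 'r set \<Rightarrow> 'r set list \<Rightarrow> 'c set \<Rightarrow> bool" where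
  "level_homogeneous f R [] X \<longleftrightarrow> (\<exists>x. X = {x})"
| "level_homogeneous f R (\<sigma> # s) X \<longleftrightarrow>
     (\<exists>A B. X = A \<union> B \<and> level_homogeneous f R s A \<and> level_homogeneous f R s B \<and> separated f R \<sigma> A B)"

lemma level_homogeneous_card:
  "level_homogeneous f R s X \<Longrightarrow> finite X \<and> card X = 2 ^ length s"
proof (induction s arbitrary: X)
  case (Cons \<sigma> s)
  then obtain A B where AB: "X = A \<union> B" "level_homogeneous f R s A" "level_homogeneous f R s B"
    "separated f R \<sigma> A B" by auto
  have "A \<inter> B = {}" using AB(4) by (auto simp: separated_def)
  then show ?case using Cons.IH[OF AB(2)] Cons.IH[OF AB(3)] AB(1) by (simp add: card_Un_disjoint)
qed auto

text \<open>Dropping a level replaces every node on it by its left subtree, and passing to subsets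
  keeps the separations at the remaining nodes. This serves both to truncate a list of labels and to
  select levels from it.\<close>

lemma level_homogeneous_subseq:
  assumes "subseq t s" "level_homogeneous f R s X"
  shows "\<exists>Y\<subseteq>X. level_homogeneous f R t Y"
  using assms
proof (induction arbitrary: X)
  case (list_emb_Nil s)
  then have "X \<noteq> {}" using level_homogeneous_card[of f R s X] by auto
  then show ?case by auto
next
  case (list_emb_Cons t s \<sigma>)
  then obtain A B where "X = A \<union> B" "level_homogeneous f R s A" by auto
  then show ?case using list_emb_Cons.IH by blast
next
  case (list_emb_Cons2 \<tau> \<sigma> t s)
  then obtain A B where AB: "X = A \<union> B" "level_homogeneous f R s A" "level_homogeneous f R s B"
    "separated f R \<sigma> A B" by auto
  obtain A' B' where "A' \<subseteq> A" "level_homogeneous f R t A'" "B' \<subseteq> B" "level_homogeneous f R t B'"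
    using list_emb_Cons2.IH[OF AB(2)] list_emb_Cons2.IH[OF AB(3)] by auto
  moreover from this have "separated f R \<tau> A' B'"
    using AB(4) list_emb_Cons2.hyps by (auto simp: separated_def subset_iff)
  ultimately show ?case using AB(1)
    by (intro exI[of _ "A' \<union> B'"]) auto
qed

text \<open>Two distinct columns are separated at the node where their branches part, and the sign
  of \<open>r\<close> there fixes the order of their values. The antitone version that follows
  treats the opposite sign in the same way.\<close>

lemma level_homogeneous_mono_on:
  assumes "level_homogeneous f R s X" "r \<in> R" "\<And>\<sigma>. \<sigma> \<in> set s \<Longrightarrow> r \<in> \<sigma>"
  shows "mono_on X (f r)"
  using assms
proof (induction s arbitrary: X)
  case (Cons \<sigma> s)
  then obtain A B where AB: "X = A \<union> B" "level_homogeneous f R s A" "level_homogeneous f R s B"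
    "separated f R \<sigma> A B" by auto
  have "mono_on A (f r)" "mono_on B (f r)" using Cons AB by auto
  moreover have "x < y \<and> f r x \<le> f r y" if "x \<in> A" "y \<in> B" for x y
    using AB(4) Cons.prems that by (force simp: separated_def)
  ultimately show ?case unfolding AB(1) monotone_on_def by (metis UnE leD)
qed (auto simp: monotone_on_def)

lemma level_homogeneous_antimono_on:
  assumes "level_homogeneous f R s X" "r \<in> R" "\<And>\<sigma>. \<sigma> \<in> set s \<Longrightarrow> r \<notin> \<sigma>"
  shows "antimono_on X (f r)"
  using assms
proof (induction s arbitrary: X)
  case (Cons \<sigma> s)
  then obtain A B where AB: "X = A \<union> B" "level_homogeneous f R s A" "level_homogeneous f R s B"
    "separated f R \<sigma> A B" by auto
  have "antimono_on A (f r)" "antimono_on B (f r)" using Cons AB by auto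
  moreover have "x < y \<and> f r y \<le> f r x" if "x \<in> A" "y \<in> B" for x y
    using AB(4) Cons.prems that by (force simp: separated_def)
  ultimately show ?case unfolding AB(1) monotone_on_def by (metis UnE leD)
qed (auto simp: monotone_on_def)

section \<open>Separated pairs of column sets, by halving\<close>

lemma exists_median:
  fixes g :: "'c \<Rightarrow> 'a::linorder"
  assumes A: "finite A" "2 * p \<le> card A" and p: "0 < p"
  shows "\<exists>t. p \<le> card {a \<in> A. g a \<le> t} \<and> p \<le> card {a \<in> A. t \<le> g a}"
proof -
  \<comment> \<open>\<open>Min T\<close> is the \<open>p\<close>-th smallest value of
    \<open>g\<close> on \<open>A\<close>, counted with multiplicity. Fewer than \<open>p\<close>
    elements lie strictly below it, so at least \<open>p\<close> of the \<open>2 * p\<close> or more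
    elements lie at or above it.\<close>
  define T where "T = {t \<in> g ` A. p \<le> card {a \<in> A. g a \<le> t}}"
  have "A \<noteq> {}" using assms by auto
  then have "{a \<in> A. g a \<le> Max (g ` A)} = A" "Max (g ` A) \<in> g ` A" using A(1) by auto
  then have "Max (g ` A) \<in> T" using A(2) by (simp add: T_def)
  moreover have fin: "finite T" using A(1) by (simp add: T_def)
  ultimately have t: "Min T \<in> T" by (intro Min_in) auto
  have low: "card {a \<in> A. g a < Min T} < p"
  proof (cases "{a \<in> A. g a < Min T} = {}")
    case True
    show ?thesis unfolding True using p by simp
  next
    case False
    define B where "B = {a \<in> A. g a < Min T}"
    have B: "finite B" "B \<noteq> {}" using A(1) False by (auto simp: B_def)
    \<comment> \<open>\<open>u\<close> is the largest value below \<open>Min T\<close>. By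
      minimality it is not in \<open>T\<close>, so fewer than \<open>p\<close> elements have value
      at most \<open>u\<close>, and these include all of \<open>B\<close>.\<close>
    define u where "u = Max (g ` B)"
    have "u \<in> g ` B" unfolding u_def using B by (intro Max_in) auto
    then have u: "u \<in> g ` A" "u < Min T" by (auto simp: B_def)
    then have "u \<notin> T" using Min_le[OF fin] by force
    then have "card {a \<in> A. g a \<le> u} < p" using u by (auto simp: T_def)
    moreover have "B \<subseteq> {a \<in> A. g a \<le> u}" using B by (auto simp: B_def u_def)
    then have "card B \<le> card {a \<in> A. g a \<le> u}" using A(1) by (intro card_mono) auto
    ultimately show ?thesis by (simp add: B_def)
  qed
  have "A = {a \<in> A. g a < Min T} \<union> {a \<in> A. Min T \<le> g a}" by auto
  then have "card A \<le> card {a \<in> A. g a < Min T} + card {a \<in> A. Min T \<le> g a}"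
    by (metis card_Un_le)
  then show ?thesis using t low A(2) by (intro exI[of _ "Min T"]) (auto simp: T_def)
qed

text \<open>Cut at a median value \<open>t\<close> of \<open>g\<close> on \<open>A\<close>. At least
  half of \<open>B\<close> lies on one side of \<open>t\<close>; pair that part with the half of
  \<open>A\<close> on the opposite side.\<close>

lemma halve_pair:
  fixes g :: "'c \<Rightarrow> 'a::linorder"
  assumes "finite A" "finite B" "2 * p \<le> card A" "2 * p \<le> card B"
  shows "\<exists>A' B'. A' \<subseteq> A \<and> B' \<subseteq> B \<and> p \<le> card A' \<and> p \<le> card B' \<and>
    ((\<forall>x\<in>A'. \<forall>y\<in>B'. g x \<le> g y) \<or> (\<forall>x\<in>A'. \<forall>y\<in>B'. g y \<le> g x))"
proof (cases "p = 0")
  case True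
  then show ?thesis by (intro exI[of _ "{}"]) auto
next
  case False
  then obtain t where t: "p \<le> card {a \<in> A. g a \<le> t}" "p \<le> card {a \<in> A. t \<le> g a}"
    using exists_median[of A p g] assms by auto
  have "B = {b \<in> B. g b \<le> t} \<union> {b \<in> B. t \<le> g b}" by auto
  then have "card B \<le> card {b \<in> B. g b \<le> t} + card {b \<in> B. t \<le> g b}" by (metis card_Un_le)
  then consider "p \<le> card {b \<in> B. g b \<le> t}" | "p \<le> card {b \<in> B. t \<le> g b}"
    using assms by linarith
  then show ?thesis
  proof cases
    case 1
    then show ?thesis using t
      by (intro exI[of _ "{a \<in> A. t \<le> g a}"] exI[of _ "{b \<in> B. g b \<le> t}"]) auto
  next
    case 2
    then show ?thesis using t
      by (intro exI[of _ "{a \<in> A. g a \<le> t}"] exI[of _ "{b \<in> B. t \<le> g b}"]) auto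
  qed
qed

lemma separated_pair:
  fixes f :: "'r \<Rightarrow> 'c::linorder \<Rightarrow> 'a::linorder"
  assumes "finite R" "finite A" "finite B" "2 ^ card R * p \<le> card A" "2 ^ card R * p \<le> card B"
    and "\<forall>x\<in>A. \<forall>y\<in>B. x < y"
  shows "\<exists>A' B' \<sigma>. A' \<subseteq> A \<and> B' \<subseteq> B \<and> p \<le> card A' \<and> p \<le> card B' \<and> \<sigma> \<subseteq> R \<and> separated f R \<sigma> A' B'"
  using assms
proof (induction R arbitrary: A B rule: finite_induct)
  case empty
  then show ?case by (intro exI[of _ A] exI[of _ B] exI[of _ "{}"]) (auto simp: separated_def)
next
  case (insert r R)
  have "2 * (2 ^ card R * p) \<le> card A" "2 * (2 ^ card R * p) \<le> card B"
    using insert by (simp_all add: mult.assoc)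
  from halve_pair[OF insert.prems(1,2) this, of "f r"] obtain A' B' where
    AB: "A' \<subseteq> A" "B' \<subseteq> B" "2 ^ card R * p \<le> card A'" "2 ^ card R * p \<le> card B'" and
    sgn: "(\<forall>x\<in>A'. \<forall>y\<in>B'. f r x \<le> f r y) \<or> (\<forall>x\<in>A'. \<forall>y\<in>B'. f r y \<le> f r x)" by blast
  have "finite A'" "finite B'" "\<forall>x\<in>A'. \<forall>y\<in>B'. x < y"
    using AB insert.prems by (auto intro: finite_subset)
  from insert.IH[OF this(1,2) AB(3,4) this(3)] obtain A'' B'' \<sigma> where
    s: "A'' \<subseteq> A'" "B'' \<subseteq> B'" "p \<le> card A''" "p \<le> card B''" "\<sigma> \<subseteq> R" "separated f R \<sigma> A'' B''"
    by blast
  \<comment> \<open>If both directions hold, \<open>r\<close> counts as positive. In the else branch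
    \<open>sgn\<close> leaves only the decreasing direction, and \<open>r\<close> is recorded as
    negative because \<open>\<sigma> \<subseteq> R\<close> does not contain it.\<close>
  define \<tau> where "\<tau> = (if \<forall>x\<in>A'. \<forall>y\<in>B'. f r x \<le> f r y then Set.insert r \<sigma> else \<sigma>)"
  have "r \<notin> \<sigma>" using s(5) insert.hyps by auto
  have "separated f (Set.insert r R) \<tau> A'' B''"
    unfolding separated_def
  proof (intro ballI conjI)
    fix x y q assume xy: "x \<in> A''" "y \<in> B''"
    then show "x < y" using s(6) by (auto simp: separated_def)
    assume q: "q \<in> Set.insert r R"
    show "if q \<in> \<tau> then f q x \<le> f q y else f q y \<le> f q x"
    proof (cases "q = r")
      case True
      then show ?thesis using xy s(1,2) sgn \<open>r \<notin> \<sigma>\<close> by (auto simp: \<tau>_def subset_iff)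
    next
      case False
      then have "q \<in> \<tau> \<longleftrightarrow> q \<in> \<sigma>" by (auto simp: \<tau>_def)
      then show ?thesis using False q xy s(6) by (auto simp: separated_def)
    qed
  qed
  moreover have "\<tau> \<subseteq> Set.insert r R" using s(5) by (auto simp: \<tau>_def)
  ultimately show ?case using s(1-4) AB(1,2)
    by (intro exI[of _ A''] exI[of _ B''] exI[of _ \<tau>]) auto
qed

lemma split_finite_set:
  fixes C :: "'c::linorder set"
  assumes "finite C" "p + q \<le> card C"
  shows "\<exists>A B. A \<subseteq> C \<and> B \<subseteq> C \<and> card A = p \<and> q \<le> card B \<and> (\<forall>x\<in>A. \<forall>y\<in>B. x < y)"
  using assms
proof (induction p arbitrary: C)
  case 0
  then show ?case by (intro exI[of _ "{}"] exI[of _ C]) auto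
next
  case (Suc p)
  have ne: "C \<noteq> {}" using Suc.prems(2) by auto
  define c where "c = Min C"
  have c: "c \<in> C" "\<And>x. x \<in> C \<Longrightarrow> c \<le> x" using ne Suc.prems(1) by (auto simp: c_def)
  have "p + q \<le> card (C - {c})" using Suc.prems c by simp
  then obtain A B where AB: "A \<subseteq> C - {c}" "B \<subseteq> C - {c}" "card A = p" "q \<le> card B"
    "\<forall>x\<in>A. \<forall>y\<in>B. x < y" using Suc.IH[of "C - {c}"] Suc.prems(1) by auto
  have "finite A" using AB(1) Suc.prems(1) by (auto intro: finite_subset)
  then have "card (insert c A) = Suc p" using AB by (subst card_insert_disjoint) auto
  moreover have "\<forall>x\<in>insert c A. \<forall>y\<in>B. x < y" using AB c(2) by (force simp: subset_iff)
  ultimately show ?case using AB c(1) by (intro exI[of _ "insert c A"] exI[of _ B]) auto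
qed

section \<open>Counting the patterns of a column set from below\<close>

text \<open>
  Recording the depth of each node next to its label makes the patterns through the root of a tree
  differ from all patterns of its two subtrees; this is what lets the count double at each step.
\<close>

definition patterns :: "('r \<Rightarrow> 'c::linorder \<Rightarrow> 'a::linorder) \<Rightarrow> 'r set \<Rightarrow> nat \<Rightarrow> 'c set \<Rightarrow> (nat \<times> 'r set) list set" where
  "patterns f R d C = {s. length s \<le> d \<and> set s \<subseteq> {..<d} \<times> Pow R \<and> (\<exists>X\<subseteq>C. level_homogeneous f R (map snd s) X)}"

lemma finite_patterns:
  assumes "finite R"
  shows "finite (patterns f R d C)"
proof (rule finite_subset)
  show "patterns f R d C \<subseteq> {s. set s \<subseteq> {..<d} \<times> Pow R \<and> length s \<le> d}"
    by (auto simp: patterns_def)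
  show "finite {s. set s \<subseteq> {..<d} \<times> Pow R \<and> length s \<le> d}"
    using assms by (intro finite_lists_length_le) auto
qed

lemma patterns_mono:
  assumes "d \<le> e" "C \<subseteq> D"
  shows "patterns f R d C \<subseteq> patterns f R e D"
proof
  fix s assume "s \<in> patterns f R d C"
  then obtain X where "length s \<le> d" "set s \<subseteq> {..<d} \<times> Pow R" "X \<subseteq> C" "level_homogeneous f R (map snd s) X"
    by (auto simp: patterns_def)
  moreover have "{..<d} \<times> Pow R \<subseteq> {..<e} \<times> Pow R" using assms(1) by auto
  ultimately show "s \<in> patterns f R e D"
    unfolding patterns_def using assms by (blast intro: order_trans)
qed

text \<open>Induction on \<open>d\<close> with inclusion-exclusion: patterns of either half are
  patterns of the whole, and each pattern common to both halves yields one more by prefixing the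
  root label. The total is at least the sum of the two counts, that is,
  \<open>2 * 2 ^ d\<close>.\<close>

lemma card_patterns_ge:
  fixes f :: "'r \<Rightarrow> 'c::linorder \<Rightarrow> 'a::linorder"
  assumes "finite R" "finite C" "2 ^ ((card R + 1) * d) \<le> card C"
  shows "2 ^ d \<le> card (patterns f R d C)"
  using assms(2,3)
proof (induction d arbitrary: C)
  case 0
  then obtain x where "x \<in> C" by fastforce
  then have "[] \<in> patterns f R 0 C" by (auto simp: patterns_def)
  then show ?case using finite_patterns[OF assms(1), of f 0 C] by (auto simp: Suc_le_eq card_gt_0_iff)
next
  case (Suc d)
  \<comment> \<open>One step of the recursion costs a factor 2 for splitting \<open>C\<close> into a
    left and a right part and a factor \<open>2 ^ card R\<close> for one halving per row.\<close>
  define p where "p = (2::nat) ^ ((card R + 1) * d)"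
  have "2 ^ card R * p + 2 ^ card R * p = 2 ^ ((card R + 1) * Suc d)"
    by (simp add: p_def power_add)
  then obtain A B where "A \<subseteq> C" "B \<subseteq> C" "2 ^ card R * p \<le> card A" "2 ^ card R * p \<le> card B"
    and "\<forall>x\<in>A. \<forall>y\<in>B. x < y"
    using split_finite_set[OF Suc.prems(1), of "2 ^ card R * p" "2 ^ card R * p"] Suc.prems(2) by auto
  moreover have "finite A" "finite B" using calculation Suc.prems(1) by (auto intro: finite_subset)
  ultimately obtain A' B' \<sigma> where AB: "A' \<subseteq> A" "B' \<subseteq> B" "p \<le> card A'" "p \<le> card B'" "\<sigma> \<subseteq> R"
    "separated f R \<sigma> A' B'" "A' \<subseteq> C" "B' \<subseteq> C"
    using separated_pair[OF assms(1), of A B p f] by (meson subset_trans)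
  define G where "G = patterns f R d"
  \<comment> \<open>The root carries the number \<open>d\<close>, while patterns in
    \<open>G A'\<close> and \<open>G B'\<close> use only numbers below \<open>d\<close>; hence
    \<open>E\<close> is disjoint from both.\<close>
  define E where "E = (\<lambda>s. (d, \<sigma>) # s) ` (G A' \<inter> G B')"
  have fin: "finite (G A')" "finite (G B')" by (simp_all add: G_def finite_patterns assms(1))
  have "2 ^ d \<le> card (G A')" "2 ^ d \<le> card (G B')"
    using Suc.IH[of A'] Suc.IH[of B'] AB Suc.prems(1) by (auto simp: G_def p_def intro: finite_subset)
  then have "2 ^ Suc d \<le> card (G A' \<union> G B') + card (G A' \<inter> G B')"
    using card_Un_Int[OF fin] by simp
  also have "card (G A' \<inter> G B') = card E" by (simp add: E_def card_image inj_on_def)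
  also have "card (G A' \<union> G B') + card E = card ((G A' \<union> G B') \<union> E)"
    using fin by (intro card_Un_disjoint[symmetric]) (auto simp: E_def G_def patterns_def)
  also have "\<dots> \<le> card (patterns f R (Suc d) C)"
  proof (intro card_mono finite_patterns assms(1) Un_least)
    show "G A' \<subseteq> patterns f R (Suc d) C" "G B' \<subseteq> patterns f R (Suc d) C"
      unfolding G_def by (intro patterns_mono AB le_SucI order_refl)+
    show "E \<subseteq> patterns f R (Suc d) C"
    proof
      fix t assume "t \<in> E"
      then obtain s where t: "t = (d, \<sigma>) # s" and s: "s \<in> G A'" "s \<in> G B'" by (auto simp: E_def)
      obtain X Y where X: "X \<subseteq> A'" "level_homogeneous f R (map snd s) X"
        and Y: "Y \<subseteq> B'" "level_homogeneous f R (map snd s) Y"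
        using s by (auto simp: G_def patterns_def)
      have "separated f R \<sigma> X Y" using AB(6) X(1) Y(1) by (auto simp: separated_def subset_iff)
      then have "level_homogeneous f R (map snd t) (X \<union> Y)" using X Y t by auto
      moreover have "X \<union> Y \<subseteq> C" using X Y AB by auto
      moreover have "length t \<le> Suc d" "set t \<subseteq> {..<Suc d} \<times> Pow R"
        using s(1) t AB(5) by (auto simp: G_def patterns_def less_Suc_eq)
      ultimately show "t \<in> patterns f R (Suc d) C" unfolding patterns_def by blast
    qed
  qed
  finally show ?case .
qed

section \<open>Existence of a long pattern\<close>

lemma sum_power_less_power:
  fixes b :: nat
  assumes "2 \<le> b"
  shows "(\<Sum>i<k. b ^ i) < b ^ k"
proof (induction k)
  case (Suc k)
  have "(\<Sum>i<Suc k. b ^ i) < 2 * b ^ k" using Suc by simp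
  also have "\<dots> \<le> b ^ Suc k" using assms by simp
  finally show ?case .
qed simp

lemma card_short_lists_less:
  assumes "finite U" "card U \<le> b" "2 \<le> b"
  shows "card {s. set s \<subseteq> U \<and> length s < k} < b ^ k"
proof -
  have "{s. set s \<subseteq> U \<and> length s < k} = (\<Union>i<k. {s. set s \<subseteq> U \<and> length s = i})" by auto
  then have "card {s. set s \<subseteq> U \<and> length s < k} \<le> (\<Sum>i<k. card {s. set s \<subseteq> U \<and> length s = i})"
    by (simp add: card_UN_le)
  also have "\<dots> = (\<Sum>i<k. card U ^ i)" by (simp add: card_lists_length_eq assms(1))
  also have "\<dots> \<le> (\<Sum>i<k. b ^ i)" by (intro sum_mono power_mono assms) auto
  also have "\<dots> < b ^ k" by (rule sum_power_less_power[OF assms(3)])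
  finally show ?thesis .
qed

text \<open>The alphabet \<open>U\<close> has
  \<open>d * 2 ^ card R \<le> 2 ^ (4 * card R) = b\<close> letters, so fewer than
  \<open>b ^ k\<close> lists over it are shorter than \<open>k\<close>. The choice of
  \<open>d\<close> makes \<open>b ^ k = 2 ^ d\<close>, the lower bound for the number of patterns;
  hence some pattern has length at least \<open>k\<close> and can be truncated.\<close>

lemma exists_long_pattern:
  fixes f :: "'r \<Rightarrow> 'c::linorder \<Rightarrow> 'a::linorder"
  assumes R: "finite R" "0 < card R" and C: "finite C" "2 ^ ((card R + 1) * d) \<le> card C"
    and d: "d = 4 * card R * k" "d \<le> 2 ^ (3 * card R)"
  shows "\<exists>s X. length s = k \<and> set s \<subseteq> Pow R \<and> X \<subseteq> C \<and> level_homogeneous f R s X"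
proof -
  define U where "U = {..<d} \<times> Pow R"
  define b where "b = (2::nat) ^ (4 * card R)"
  have U: "finite U" "card U \<le> b"
  proof -
    have "card U = d * 2 ^ card R" using R by (simp add: U_def card_Pow card_cartesian_product)
    also have "\<dots> \<le> 2 ^ (3 * card R) * 2 ^ card R" using d(2) by simp
    finally show "card U \<le> b" by (simp add: b_def power_add[symmetric])
  qed (use R in \<open>simp add: U_def\<close>)
  have "(2::nat) ^ 1 \<le> 2 ^ (4 * card R)" using R(2) by (intro power_increasing) auto
  then have b: "2 \<le> b" by (simp add: b_def)
  have finite_short: "finite {s. set s \<subseteq> U \<and> length s < k}"
    by (rule finite_subset[OF _ finite_lists_length_le[OF U(1), of k]]) auto
  have "card {s. set s \<subseteq> U \<and> length s < k} < b ^ k"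
    by (rule card_short_lists_less[OF U b])
  also have "b ^ k = 2 ^ d" by (simp add: b_def d power_mult)
  also have "\<dots> \<le> card (patterns f R d C)" by (rule card_patterns_ge[OF R(1) C])
  finally have "\<not> patterns f R d C \<subseteq> {s. set s \<subseteq> U \<and> length s < k}"
    using card_mono[OF finite_short] leD by blast
  then obtain s where s: "s \<in> patterns f R d C" "\<not> (set s \<subseteq> U \<and> length s < k)" by blast
  moreover have "set s \<subseteq> U" using s(1) by (auto simp: patterns_def U_def)
  ultimately have k: "k \<le> length s" by simp
  obtain X where "X \<subseteq> C" "level_homogeneous f R (map snd s) X" using s(1) by (auto simp: patterns_def)
  moreover have "subseq (take k (map snd s)) (map snd s)"
    by (metis append_take_drop_id list_emb_append2 prefix_imp_subseq take_is_prefix)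
  ultimately obtain Y where "Y \<subseteq> C" "level_homogeneous f R (take k (map snd s)) Y"
    using level_homogeneous_subseq by (metis subset_trans)
  moreover have "set (take k (map snd s)) \<subseteq> Pow R"
    using s(1) set_take_subset[of k "map snd s"] by (fastforce simp: patterns_def)
  ultimately show ?thesis using k by (intro exI[of _ "take k (map snd s)"] exI[of _ Y]) simp
qed

section \<open>Selecting levels on which many rows agree\<close>

text \<open>Double count the pairs of a row \<open>r\<close> and a \<open>j\<close>-subset
  \<open>J\<close> of \<open>E r\<close>. Each row contributes at least \<open>h choose j\<close>
  pairs, so some \<open>J\<close> reaches the average, which is at least \<open>n\<close>.\<close>

lemma exists_popular_subset:
  assumes R: "finite R" and K: "finite K" "j \<le> card K"
    and E: "\<And>r. r \<in> R \<Longrightarrow> E r \<subseteq> K \<and> h \<le> card (E r)"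
    and n: "n * (card K choose j) \<le> card R * (h choose j)"
  shows "\<exists>J\<subseteq>K. card J = j \<and> n \<le> card {r \<in> R. J \<subseteq> E r}"
proof (rule ccontr)
  define JJ where "JJ = {J. J \<subseteq> K \<and> card J = j}"
  assume "\<not> ?thesis"
  then have less: "card {r \<in> R. J \<subseteq> E r} < n" if "J \<in> JJ" for J
    using that by (force simp: JJ_def)
  have JJ: "finite JJ" "card JJ = card K choose j" using K by (simp_all add: JJ_def n_subsets)
  then have ne: "JJ \<noteq> {}" using K(2) by (metis card.empty zero_less_binomial less_irrefl)
  have "card R * (h choose j) = (\<Sum>r\<in>R. h choose j)" by simp
  also have "\<dots> \<le> (\<Sum>r\<in>R. card {J \<in> JJ. J \<subseteq> E r})"
  proof (rule sum_mono)
    fix r assume r: "r \<in> R"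
    have "{J \<in> JJ. J \<subseteq> E r} = {J. J \<subseteq> E r \<and> card J = j}" using E[OF r] by (auto simp: JJ_def)
    moreover have "finite (E r)" using E[OF r] K(1) finite_subset by blast
    ultimately have "card {J \<in> JJ. J \<subseteq> E r} = card (E r) choose j" by (simp add: n_subsets)
    then show "h choose j \<le> card {J \<in> JJ. J \<subseteq> E r}" using E[OF r] by (simp add: binomial_right_mono)
  qed
  also have "\<dots> = (\<Sum>J\<in>JJ. card {r \<in> R. J \<subseteq> E r})"
    using R JJ(1) by (intro sum_multicount_gen[symmetric]) auto
  also have "\<dots> < (\<Sum>J\<in>JJ. n)" using JJ(1) ne less by (intro sum_strict_mono) auto
  also have "\<dots> = n * (card K choose j)" by (simp add: JJ mult.commute)
  finally show False using n by simp
qed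

text \<open>Each row has some sign on at least half of the \<open>2 * h\<close> levels, and one sign
  \<open>b\<close> serves at least half of the rows. The factor 2 in the last assumption pays for
  restricting to these rows, to which the double counting is applied.\<close>

lemma exists_monochromatic_block:
  assumes R: "finite R" and j: "j \<le> 2 * h" and s: "length s = 2 * h"
    and n: "2 * n * (2 * h choose j) \<le> card R * (h choose j)"
  shows "\<exists>t S. subseq t s \<and> length t = j \<and> S \<subseteq> R \<and> n \<le> card S \<and>
    ((\<forall>r\<in>S. \<forall>\<sigma>\<in>set t. r \<in> \<sigma>) \<or> (\<forall>r\<in>S. \<forall>\<sigma>\<in>set t. r \<notin> \<sigma>))"
proof -
  \<comment> \<open>\<open>E b r\<close> collects the levels on which row \<open>r\<close> has sign
    \<open>b\<close>. A row with exactly \<open>h\<close> levels of each sign lies in both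
    \<open>T True\<close> and \<open>T False\<close>.\<close>
  define E where "E b r = {i \<in> {..<2 * h}. (r \<in> s ! i) = b}" for b r
  define T where "T b = {r \<in> R. h \<le> card (E b r)}" for b
  have halves: "2 * h \<le> card (E True r) + card (E False r)" for r
  proof -
    have "{..<2 * h} = E True r \<union> E False r" by (auto simp: E_def)
    then show ?thesis by (metis card_Un_le card_lessThan)
  qed
  have "R \<subseteq> T True \<union> T False"
  proof
    fix r assume "r \<in> R"
    then show "r \<in> T True \<union> T False" using halves[of r] by (auto simp: T_def)
  qed
  then have "card R \<le> card (T True \<union> T False)" using R by (intro card_mono) (auto simp: T_def)
  then have "card R \<le> card (T True) + card (T False)" using card_Un_le order_trans by blast
  then obtain b where "card R \<le> 2 * card (T b)" by (metis add_le_mono mult_2 linorder_linear order_trans)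
  then have "2 * n * (2 * h choose j) \<le> 2 * card (T b) * (h choose j)"
    using n by (meson mult_le_mono1 order_trans)
  then have "n * (card {..<2 * h} choose j) \<le> card (T b) * (h choose j)" by simp
  then have "\<exists>J\<subseteq>{..<2 * h}. card J = j \<and> n \<le> card {r \<in> T b. J \<subseteq> E b r}"
    using R j by (intro exists_popular_subset[where h = h]) (auto simp: T_def E_def)
  then obtain J where J: "J \<subseteq> {..<2 * h}" "card J = j" "n \<le> card {r \<in> T b. J \<subseteq> E b r}" by blast
  have "{i. i < length s \<and> i \<in> J} = J" using J(1) s by auto
  then have "length (nths s J) = j" using J(2) by (simp add: length_nths)
  moreover have "(r \<in> \<sigma>) = b" if "J \<subseteq> E b r" "\<sigma> \<in> set (nths s J)" for r \<sigma>
    using that by (auto simp: set_nths E_def)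
  ultimately show ?thesis using J(3)
    by (intro exI[of _ "nths s J"] exI[of _ "{r \<in> T b. J \<subseteq> E b r}"])
       (cases b; auto simp: T_def subseq_conv_nths)
qed

text \<open>The quotient of the two binomials is the product over \<open>i < j\<close> of
  \<open>(2 * h - i) / (h - i) = 2 * (1 + i / (2 * (h - i)))\<close>. With \<open>h\<close>
  quadratic in \<open>j\<close>, each factor is at most \<open>x = 2 * (1 + 1 / (2 * j))\<close>,
  and \<open>x ^ j \<le> 2 ^ j * exp (1 / 2)\<close>.\<close>

lemma choose_double_le:
  fixes j :: nat
  defines "h \<equiv> 2 * j ^ 2"
  shows "2 * h choose j \<le> 2 * 2 ^ j * (h choose j)"
proof (cases "j = 0")
  case False
  have jh: "j + j ^ 2 \<le> h" using False by (simp add: h_def power2_eq_square)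
  then have jh': "j \<le> h" by simp
  define x where "x = 2 * (1 + 1 / (2 * real j))"
  have "real (2 * h choose j) = (\<Prod>i<j. real (2 * h - i) / real (j - i))"
    using jh' by (simp add: binomial_altdef_of_nat lessThan_atLeast0)
  also have "\<dots> \<le> (\<Prod>i<j. x * (real (h - i) / real (j - i)))"
  proof (intro prod_mono conjI)
    fix i assume "i \<in> {..<j}"
    then have i: "i < j" by simp
    have "real i \<le> (real h - real i) / real j"
    proof -
      have "i * j + i \<le> h"
      proof -
        have "i * j \<le> j * j" using i by simp
        then show ?thesis using i jh unfolding power2_eq_square by linarith
      qed
      then have "real i * real j + real i \<le> real h" by (metis of_nat_add of_nat_le_iff of_nat_mult)
      then show ?thesis using False by (simp add: field_simps)
    qed
    then have "real (2 * h - i) \<le> x * real (h - i)"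
      using i jh' False by (simp add: x_def of_nat_diff field_simps)
    then show "real (2 * h - i) / real (j - i) \<le> x * (real (h - i) / real (j - i))"
      using i by (simp add: divide_right_mono)
  qed simp
  also have "\<dots> = x ^ j * real (h choose j)"
    unfolding prod.distrib using jh' by (simp add: binomial_altdef_of_nat lessThan_atLeast0)
  also have "x ^ j \<le> 2 ^ j * 2"
  proof -
    have "(1 + 1 / (2 * real j)) ^ j \<le> exp (1 / (2 * real j)) ^ j"
      by (intro power_mono exp_ge_add_one_self) simp
    also have "\<dots> = exp (1 / 2)" using False by (simp add: exp_of_nat_mult[symmetric])
    also have "\<dots> \<le> 2"
    proof -
      have "exp (1 / 2 :: real) \<le> 1 + 1 / 2 + (1 / 2)\<^sup>2" by (rule exp_bound) auto
      also have "\<dots> \<le> 2" by (simp add: power2_eq_square)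
      finally show ?thesis .
    qed
    finally show ?thesis unfolding x_def power_mult_distrib by simp
  qed
  finally have "real (2 * h choose j) \<le> real (2 * 2 ^ j * (h choose j))" by (simp add: mult_ac mult_right_mono)
  then show ?thesis by (simp only: of_nat_le_iff)
qed (simp add: h_def)

section \<open>Choice of parameters and the monotone block\<close>

lemma exists_monotone_block:
  fixes f :: "'r \<Rightarrow> 'c::linorder \<Rightarrow> 'a::linorder"
  assumes R: "finite R" "card R = 8 * n ^ 2" and n: "n \<le> 2 ^ j" "2 ^ j < 2 * n"
    and C: "finite C" "2 ^ (2048 * n ^ 4 * j ^ 2) \<le> card C"
  shows "\<exists>S X. S \<subseteq> R \<and> card S = n \<and> X \<subseteq> C \<and> card X = n \<and>
    ((\<forall>r\<in>S. mono_on X (f r)) \<or> (\<forall>r\<in>S. antimono_on X (f r)))"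
proof -
  \<comment> \<open>This \<open>h\<close> is the one of \<open>choose_double_le\<close>, and
    \<open>d\<close> is \<open>4 * m * k\<close> for \<open>k = 2 * h\<close> levels, as
    \<open>exists_long_pattern\<close> requires.\<close>
  define h where "h = 2 * j ^ 2"
  define m where "m = card R"
  define d where "d = 4 * m * (2 * h)"
  have "n \<noteq> 0" using n by (cases n) auto
  then have "n ^ 2 \<ge> 1" by simp
  then have m: "m = 8 * n ^ 2" "8 \<le> m" using R by (simp_all add: m_def)
  \<comment> \<open>From \<open>2 * j \<le> 2 ^ j < 2 * n\<close> follows \<open>j \<le> n\<close>,
    hence \<open>d = 16 * m * j ^ 2 \<le> (4 * m) ^ 2\<close>. Since \<open>m \<ge> 8\<close> gives
    \<open>4 * m \<le> 2 ^ m\<close>, the bound on \<open>d\<close> in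
    \<open>exists_long_pattern\<close> holds.\<close>
  have "2 * j \<le> 2 ^ j"
  proof (cases j)
    case (Suc i)
    then show ?thesis using Suc_leI[OF less_exp[of i]] by simp
  qed simp
  then have "j \<le> n" using n by linarith
  then have "j ^ 2 \<le> n ^ 2" by (intro power_mono) auto
  then have j2: "j ^ 2 \<le> m" using m(1) by linarith
  have "d = 16 * m * j ^ 2" by (simp add: d_def h_def)
  also have "\<dots> \<le> 16 * m * m" using j2 by simp
  also have "\<dots> \<le> 2 ^ (3 * m)"
  proof -
    have "4 * m \<le> 2 ^ m" using m(2)
    proof (induction m rule: dec_induct)
      case (step k)
      then show ?case by simp
    qed simp
    then have "(4 * m) ^ 2 \<le> (2 ^ m) ^ 2" by (rule power_mono) simp
    also have "\<dots> \<le> 2 ^ (3 * m)" by (simp add: power_mult[symmetric])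
    finally show ?thesis by (simp add: power2_eq_square)
  qed
  finally have d: "d \<le> 2 ^ (3 * card R)" by (simp add: m_def)
  \<comment> \<open>Here 2048 arises: \<open>2 * m * d = 32 * m ^ 2 * j ^ 2\<close> with
    \<open>m = 8 * n ^ 2\<close>.\<close>
  have "(m + 1) * d \<le> (2 * m) * d" using m(2) by (intro mult_right_mono) auto
  also have "\<dots> = 2048 * n ^ 4 * j ^ 2"
    by (simp add: d_def h_def m(1) power2_eq_square power4_eq_xxxx)
  finally have "(2::nat) ^ ((m + 1) * d) \<le> 2 ^ (2048 * n ^ 4 * j ^ 2)" by (intro power_increasing) auto
  then have Cd: "2 ^ ((card R + 1) * d) \<le> card C"
    unfolding m_def using C(2) by (rule order_trans)
  obtain s X where s: "length s = 2 * h" "X \<subseteq> C" "level_homogeneous f R s X"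
    using exists_long_pattern[OF R(1) _ C(1) Cd, of "2 * h" f] m(2) d by (auto simp: d_def m_def)
  \<comment> \<open>This explains the \<open>8 * n ^ 2\<close> rows: \<open>2 * n\<close> for the
    majority sign, 2 for the loss in \<open>choose_double_le\<close>, and \<open>2 * n\<close> for
    the bound on \<open>2 ^ j\<close>.\<close>
  have "2 * n * (2 * h choose j) \<le> 2 * n * (2 * 2 ^ j * (h choose j))"
    using choose_double_le[of j] by (simp add: h_def)
  also have "\<dots> \<le> 2 * n * (2 * (2 * n) * (h choose j))"
    using n(2) by (intro mult_left_mono mult_right_mono) auto
  also have "\<dots> = card R * (h choose j)" using R(2) by (simp add: power2_eq_square)
  finally have "2 * n * (2 * h choose j) \<le> card R * (h choose j)" .
  moreover have "j \<le> 2 * h" by (cases j) (auto simp: h_def power2_eq_square)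
  ultimately obtain t S where t: "subseq t s" "length t = j" "S \<subseteq> R" "n \<le> card S"
    "(\<forall>r\<in>S. \<forall>\<sigma>\<in>set t. r \<in> \<sigma>) \<or> (\<forall>r\<in>S. \<forall>\<sigma>\<in>set t. r \<notin> \<sigma>)"
    using exists_monochromatic_block[OF R(1) _ s(1)] by blast
  obtain Y where Y: "Y \<subseteq> X" "level_homogeneous f R t Y"
    using level_homogeneous_subseq[OF t(1) s(3)] by blast
  have "n \<le> card Y" using level_homogeneous_card[OF Y(2)] t(2) n(1) by simp
  then obtain X' where X': "X' \<subseteq> Y" "card X' = n" by (meson obtain_subset_with_card_n)
  obtain S' where S': "S' \<subseteq> S" "card S' = n" using t(4) by (meson obtain_subset_with_card_n)
  have "(\<forall>r\<in>S'. mono_on X' (f r)) \<or> (\<forall>r\<in>S'. antimono_on X' (f r))"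
    using t(5)
  proof
    assume *: "\<forall>r\<in>S. \<forall>\<sigma>\<in>set t. r \<in> \<sigma>"
    have "mono_on Y (f r)" if "r \<in> S'" for r
      by (rule level_homogeneous_mono_on[OF Y(2)]) (use that * S'(1) t(3) in auto)
    then show ?thesis using X'(1) monotone_on_subset by blast
  next
    assume *: "\<forall>r\<in>S. \<forall>\<sigma>\<in>set t. r \<notin> \<sigma>"
    have "antimono_on Y (f r)" if "r \<in> S'" for r
      by (rule level_homogeneous_antimono_on[OF Y(2)]) (use that * S'(1) t(3) in auto)
    then show ?thesis using X'(1) monotone_on_subset by blast
  qed
  then show ?thesis using S' X' t(3) Y(1) s(2) by (intro exI[of _ S'] exI[of _ X']) auto
qed

section \<open>Transfer to matrices and the final bound\<close>

lemma row_monotone_submatrix: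
  assumes I: "I \<subseteq> {..<dim_row A}" and J: "J \<subseteq> {..<dim_col A}"
    and mono: "(\<forall>i\<in>I. mono_on J (\<lambda>j. A $$ (i, j))) \<or> (\<forall>i\<in>I. antimono_on J (\<lambda>j. A $$ (i, j)))"
  shows "row_monotone (submatrix A I J)"
proof -
  have eq: "{i. i < dim_row A \<and> i \<in> I} = I" "{j. j < dim_col A \<and> j \<in> J} = J" using I J by auto
  then have dim: "dim_row (submatrix A I J) = card I" "dim_col (submatrix A I J) = card J"
    by (simp_all add: submatrix_def)
  have entry: "submatrix A I J $$ (i, j) = A $$ (pick I i, pick J j)" if "i < card I" "j < card J" for i j
    using that eq by (simp add: submatrix_def)
  have "finite J" using J finite_subset by blast
  \<comment> \<open>Reindexing columns by the increasing map \<open>pick J\<close> preserves both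
    directions of monotonicity.\<close>
  then have pick_le: "pick J k \<le> pick J l" if "k \<le> l" "l < card J" for k l
    using that strict_mono_onD[OF strict_mono_on_pick, of J k l] by (cases "k = l") auto
  show ?thesis
    using mono unfolding row_monotone_def dim
  proof (rule disj_forward; intro allI impI monotone_onI)
    fix i k l assume "\<forall>i\<in>I. mono_on J (\<lambda>j. A $$ (i, j))" "i < card I"
      and kl: "k \<in> {..<card J}" "l \<in> {..<card J}" "k \<le> l"
    then have "mono_on J (\<lambda>j. A $$ (pick I i, j))" by (simp add: pick_in_set_le)
    then show "submatrix A I J $$ (i, k) \<le> submatrix A I J $$ (i, l)"
      using kl pick_le[of k l] \<open>i < card I\<close> by (simp add: entry monotone_on_def pick_in_set_le)
  next
    fix i k l assume "\<forall>i\<in>I. antimono_on J (\<lambda>j. A $$ (i, j))" "i < card I"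
      and kl: "k \<in> {..<card J}" "l \<in> {..<card J}" "k \<le> l"
    then have "antimono_on J (\<lambda>j. A $$ (pick I i, j))" by (simp add: pick_in_set_le)
    then show "submatrix A I J $$ (i, l) \<le> submatrix A I J $$ (i, k)"
      using kl pick_le[of k l] \<open>i < card I\<close> by (simp add: entry monotone_on_def pick_in_set_le)
  qed
qed

text \<open>The least \<open>j\<close> with \<open>n \<le> 2 ^ j\<close> is at most
  \<open>1 + log 2 n\<close>, and \<open>1 \<le> log 2 n\<close> once \<open>n \<ge> 2\<close>. For
  \<open>n = 1\<close> the logarithm vanishes and \<open>j = 0\<close> fits.\<close>

lemma exists_power_two_bracket:
  assumes "1 \<le> n"
  shows "\<exists>j. n \<le> 2 ^ j \<and> 2 ^ j < 2 * n \<and> real j \<le> 2 * log 2 (real n)"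
proof (cases "n = 1")
  case True
  then show ?thesis by (intro exI[of _ 0]) simp
next
  case False
  define j where "j = (LEAST j. n \<le> (2::nat) ^ j)"
  have "n \<le> 2 ^ n" by (simp add: less_exp less_imp_le)
  then have j: "n \<le> 2 ^ j" unfolding j_def by (rule LeastI)
  obtain i where i: "j = Suc i" using j False assms by (cases j) auto
  then have "\<not> n \<le> 2 ^ i" unfolding j_def by (metis lessI not_less_Least)
  then have i2: "2 ^ i < n" by simp
  then have "real (2 ^ i) \<le> real n" by (simp only: of_nat_le_iff)
  then have "log 2 (2 ^ i) \<le> log 2 (real n)" using assms by (subst log_le_cancel_iff) auto
  then have "real i \<le> log 2 (real n)" by simp
  moreover have "log 2 2 \<le> log 2 (real n)" using False assms by (subst log_le_cancel_iff) auto
  ultimately have "real j \<le> 2 * log 2 (real n)" using i by simp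
  then show ?thesis using j i i2 by (intro exI[of _ j]) simp
qed

theorem theorem2:
  shows "\<exists>c::real. c > 0 \<and>
    (\<forall>n N :: nat. n \<ge> 1 \<longrightarrow>
       real N \<ge> 2 powr (c * real n ^ 4 * (log 2 (real n)) ^ 2) \<longrightarrow>
       (\<forall>A :: real mat. A \<in> carrier_mat (8 * n ^ 2) N \<longrightarrow>
          (\<exists>B. is_square_submatrix n A B \<and> row_monotone B)))"
proof (intro exI[of _ 8192] conjI allI impI)
  fix n N :: nat and A :: "real mat"
  assume n: "1 \<le> n" and N: "2 powr (8192 * real n ^ 4 * (log 2 (real n)) ^ 2) \<le> real N"
    and A: "A \<in> carrier_mat (8 * n ^ 2) N"
  obtain j where j: "n \<le> 2 ^ j" "2 ^ j < 2 * n" "real j \<le> 2 * log 2 (real n)"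
    using exists_power_two_bracket[OF n] by blast
  \<comment> \<open>Squaring \<open>j \<le> 2 * log 2 n\<close> costs a factor 4, which turns 2048
    into the constant 8192.\<close>
  have "real j ^ 2 \<le> (2 * log 2 (real n)) ^ 2" using j(3) by (intro power_mono) auto
  then have "2048 * real n ^ 4 * real j ^ 2 \<le> 2048 * real n ^ 4 * (2 * log 2 (real n)) ^ 2"
    by (intro mult_left_mono) auto
  then have "real (2048 * n ^ 4 * j ^ 2) \<le> 8192 * real n ^ 4 * (log 2 (real n)) ^ 2"
    by (simp add: power_mult_distrib)
  then have "2 powr real (2048 * n ^ 4 * j ^ 2) \<le> real N" using N
    by (meson one_le_numeral order_trans powr_mono)
  then have "real (2 ^ (2048 * n ^ 4 * j ^ 2)) \<le> real N" by (subst (asm) powr_realpow) auto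
  then have N': "2 ^ (2048 * n ^ 4 * j ^ 2) \<le> card {..<N}" by (simp only: of_nat_le_iff card_lessThan)
  obtain I J where "I \<subseteq> {..<8 * n ^ 2}" "card I = n" "J \<subseteq> {..<N}" "card J = n"
    "(\<forall>r\<in>I. mono_on J (\<lambda>l. A $$ (r, l))) \<or> (\<forall>r\<in>I. antimono_on J (\<lambda>l. A $$ (r, l)))"
    using exists_monotone_block[OF _ _ j(1,2) _ N', of "{..<8 * n ^ 2}" "\<lambda>r l. A $$ (r, l)"] by auto
  moreover have "dim_row A = 8 * n ^ 2" "dim_col A = N" using A by auto
  ultimately show "\<exists>B. is_square_submatrix n A B \<and> row_monotone B"
    by (intro exI[of _ "submatrix A I J"]) (auto simp: is_square_submatrix_def intro!: row_monotone_submatrix)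
qed simp

end
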